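(* Let $d = \dim\mathcal{S}$ and $1 \leq k < d$. Let $\mathcal{E}_k \subset \mathcal{S}$ be a maximal $\nabla$-autoparallel submanifold of dimension $k$, let $P_0 \in \mathcal{E}_k$, and let $\mathcal{M}_k(P_0)$ be the dual complement of $\mathcal{E}_k$ at $P_0$. Then for any $P \in \mathcal{M}_k(P_0)$ we have $P_0 = \mathrm{proj}^*_{\mathcal{E}_k}(P)$. In fact, $$\mathcal{M}_k(P_0) = (\mathrm{proj}^*_{\mathcal{E}_k})^{-1}(P_0) = \{P \in \mathcal{S} : \mathrm{proj}^*_{\mathcal{E}_k}(P) = P_0\}.$$ Consequently, for $P_0, P_1 \in \mathcal{E}_k$ with $P_0 \neq P_1$, we have $\mathcal{M}_k(P_0) \cap \mathcal{M}_k(P_1) = \emptyset$.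
   Context: Setting. Let $\alpha > 0$, let $\Theta \subset \mathbb{R}^d$ be a nonempty open convex set, and let $\varphi : \Theta \to \mathbb{R}$ be a smooth $\alpha$-exponentially concave function, i.e. $\Phi = e^{\alpha\varphi}$ is concave; assume moreover that the Hessian $\mathsf{D}^2\Phi$ is strictly negative definite at every point of $\Theta$ and that $1 - \alpha\, \mathsf{D}\varphi(\theta)\cdot\theta > 0$ for all $\theta \in \Theta$. Here $\mathsf{D}$ is the Euclidean gradient and $\cdot$ the Euclidean dot product. The $L^{(\alpha)}$-divergence of $\varphi$ is $$\mathbf{L}_\varphi^{(\alpha)}[\theta:\theta'] = \frac{1}{\alpha}\log\bigl(1 + \alpha\, \mathsf{D}\varphi(\theta')\cdot(\theta-\theta')\bigr) - (\varphi(\theta)-\varphi(\theta')), \quad \theta,\theta' \in \Theta.$$ The manifold $\mathcal{S}$ is the $d$-dimensional manifold with global (primal) coordinate system $P \mapsto \theta_P \in \Theta$ (a bijection onto $\Theta$). The dual coordinate system is $$\eta_P = \mathsf{T}(\theta_P) := \frac{\mathsf{D}\varphi(\theta_P)}{1-\alpha\,\mathsf{D}\varphi(\theta_P)\cdot\theta_P},$$ where $\mathsf{T}$ is a diffeomorphism of $\Theta$ onto its (open) range $\Omega \subset \mathbb{R}^d$. Define the divergence on $\mathcal{S}$ by $\mathbf{D}[P:Q] := \mathbf{L}_\varphi^{(\alpha)}[\theta_P:\theta_Q]$. Riemannian metric. $\langle\cdot,\cdot\rangle = g$ is the Riemannian metric on $\mathcal{S}$ induced by $\mathbf{D}$ in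 the sense of Eguchi: in primal coordinates, $$g_{ij}(\theta) = \left\langle \frac{\partial}{\partial\theta_i},\frac{\partial}{\partial\theta_j}\right\rangle = -\left.\frac{\partial^2}{\partial\theta_i\,\partial\theta'_j}\mathbf{L}_\varphi^{(\alpha)}[\theta:\theta']\right|_{\theta'=\theta}.$$ Autoparallel submanifolds. A maximal $\nabla$-autoparallel submanifold of dimension $k$ is a nonempty set of the form $\{P \in \mathcal{S} : \theta_P - \theta_{P_0} \in A_0\}$, where $P_0 \in \mathcal{S}$ and $A_0 \subset \mathbb{R}^d$ is a $k$-dimensional vector subspace. A maximal $\nabla^*$-autoparallel submanifold of dimension $d-k$ is a nonempty set of the form $\{P \in \mathcal{S} : \eta_P - \eta_{P_0} \in B_0\}$, where $P_0 \in \mathcal{S}$ and $B_0 \subset \mathbb{R}^d$ is a $(d-k)$-dimensional vector subspace. Dual complement. For $P_0 \in \mathcal{E}_k$, the dual complement $\mathcal{M}_k(P_0)$ of $\mathcal{E}_k$ at $P_0$ is the unique maximal $\nabla^*$-autoparallel submanifold of dimension $d-k$ such that $\mathcal{E}_k \cap \mathcal{M}_k(P_0) = \{P_0\}$ and $\langle u,v\rangle = 0$ for all $u \in T_{P_0}\mathcal{E}_k$, $v \in T_{P_0}\mathcal{M}_k(P_0)$. (It exists and is unique. Explicitly, if $\mathcal{E}_k = \{P : \theta_P - \theta_{P_0} \in A_0\}$, then $\mathcal{M}_k(P_0) = \{P \in \mathcal{S} : \eta_P - \eta_{P_0} \in B_0\}$, where $B_0$ is the set of $b \in \mathbb{R}^d$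 such that $\langle \sum_i a_i \frac{\partial}{\partial\theta_i}, \sum_j b_j\frac{\partial}{\partial\eta_j}\rangle = 0$ at $P_0$ for all $a \in A_0$.) Dual projection. For $\mathcal{A} \subset \mathcal{S}$ and $P \in \mathcal{S}$, an optimal solution $Q \in \mathcal{A}$ of the problem $\inf_{Q \in \mathcal{A}} \mathbf{D}[Q:P]$ is called a dual projection of $P$ onto $\mathcal{A}$ and is denoted by $\mathrm{proj}^*_{\mathcal{A}}(P)$; thus $\mathrm{proj}^*_{\mathcal{A}}(P) = P_0$ means that $P_0 \in \mathcal{A}$ attains this infimum. *)

theory Defs
  imports "HOL-Analysis.Analysis"
begin

definition partial_deriv :: "'n::finite \<Rightarrow> (real^'n \<Rightarrow> real) \<Rightarrow> real^'n \<Rightarrow> real" where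
  "partial_deriv i f x = frechet_derivative f (at x) (axis i 1)"

definition gradient :: "(real^'n \<Rightarrow> real) \<Rightarrow> real^'n \<Rightarrow> real^'n" where
  "gradient f x = (\<chi> i. partial_deriv i f x)"

definition hessian :: "(real^'n \<Rightarrow> real) \<Rightarrow> real^'n \<Rightarrow> real^'n^'n" where
  "hessian f x = (\<chi> i j. partial_deriv i (partial_deriv j f) x)"

text \<open>\<open>C_on m f U\<close>: the function \<open>f\<close> is of class $C^m$ on the open set \<open>U\<close>.\<close>

fun C_on :: "nat \<Rightarrow> (real^'n \<Rightarrow> real) \<Rightarrow> (real^'n) set \<Rightarrow> bool" where
  "C_on 0 f U = continuous_on U f"
| "C_on (Suc m) f U =
     ((\<forall>x\<in>U. f differentiable (at x)) \<and> (\<forall>i. C_on m (partial_deriv i f) U))"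

definition smooth_fun_on :: "(real^'n \<Rightarrow> real) \<Rightarrow> (real^'n) set \<Rightarrow> bool" where
  "smooth_fun_on f U \<longleftrightarrow> (\<forall>m. C_on m f U)"

definition L_divergence ::
  "real \<Rightarrow> (real^'n \<Rightarrow> real) \<Rightarrow> real^'n \<Rightarrow> real^'n \<Rightarrow> real" where
  "L_divergence \<alpha> \<phi> x x' =
     (1 / \<alpha>) * ln (1 + \<alpha> * (gradient \<phi> x' \<bullet> (x - x'))) - (\<phi> x - \<phi> x')"

definition dual_map :: "real \<Rightarrow> (real^'n \<Rightarrow> real) \<Rightarrow> real^'n \<Rightarrow> real^'n" where
  "dual_map \<alpha> \<phi> x = (1 / (1 - \<alpha> * (gradient \<phi> x \<bullet> x))) *\<^sub>R gradient \<phi> x"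

text \<open>
  The manifold is a set \<open>S\<close> of points with a global chart \<open>\<theta>\<close>, the primal coordinate
  system, which will be a bijection from \<open>S\<close> onto the domain of \<open>\<phi>\<close>.
\<close>

definition dual_coord ::
  "real \<Rightarrow> (real^'n \<Rightarrow> real) \<Rightarrow> ('p \<Rightarrow> real^'n) \<Rightarrow> 'p \<Rightarrow> real^'n" where
  "dual_coord \<alpha> \<phi> \<theta> P = dual_map \<alpha> \<phi> (\<theta> P)"

definition divergence ::
  "real \<Rightarrow> (real^'n \<Rightarrow> real) \<Rightarrow> ('p \<Rightarrow> real^'n) \<Rightarrow> 'p \<Rightarrow> 'p \<Rightarrow> real" where
  "divergence \<alpha> \<phi> \<theta> P Q = L_divergence \<alpha> \<phi> (\<theta> P) (\<theta> Q)"

definition metric_matrix :: "real \<Rightarrow> (real^'n \<Rightarrow> real) \<Rightarrow> real^'n \<Rightarrow> real^'n^'n" where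
  "metric_matrix \<alpha> \<phi> x =
     (\<chi> i j. - partial_deriv i (\<lambda>y. partial_deriv j (\<lambda>y'. L_divergence \<alpha> \<phi> y y') x) x)"

text \<open>
  Tangent vectors at a point are represented by their components with respect to the
  primal frame $\partial/\partial\theta_i$, also for submanifolds that are given in
  dual coordinates.
\<close>

definition riemann_inner ::
  "real \<Rightarrow> (real^'n \<Rightarrow> real) \<Rightarrow> ('p \<Rightarrow> real^'n) \<Rightarrow> 'p \<Rightarrow> real^'n \<Rightarrow> real^'n \<Rightarrow> real" where
  "riemann_inner \<alpha> \<phi> \<theta> P u v =
     (\<Sum>i\<in>UNIV. \<Sum>j\<in>UNIV. metric_matrix \<alpha> \<phi> (\<theta> P) $ i $ j * u $ i * v $ j)"

text \<open>The tangent space of a submanifold \<open>N\<close> at \<open>P\<close>: velocities of the $C^1$ curves in \<open>N\<close>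
  that pass through \<open>P\<close>.\<close>

definition tangent_space :: "('p \<Rightarrow> real^'n) \<Rightarrow> 'p set \<Rightarrow> 'p \<Rightarrow> (real^'n) set" where
  "tangent_space \<theta> N P =
     {v. \<exists>\<gamma> \<epsilon>. \<epsilon> > 0 \<and> \<gamma> ` {-\<epsilon><..<\<epsilon>} \<subseteq> N \<and> \<gamma> 0 = P \<and>
         (\<lambda>t. \<theta> (\<gamma> t)) C1_differentiable_on {-\<epsilon><..<\<epsilon>} \<and>
         ((\<lambda>t. \<theta> (\<gamma> t)) has_vector_derivative v) (at 0)}"

text \<open>For \<open>x = \<theta>\<close> these are the maximal $\nabla$-autoparallel submanifolds of dimension \<open>k\<close>,
  for \<open>x = dual_coord \<alpha> \<phi> \<theta>\<close> the maximal $\nabla^*$-autoparallel ones.\<close>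

definition maximal_autoparallel ::
  "'p set \<Rightarrow> ('p \<Rightarrow> real^'n) \<Rightarrow> nat \<Rightarrow> 'p set \<Rightarrow> bool" where
  "maximal_autoparallel S x k N \<longleftrightarrow>
     (\<exists>P\<^sub>0\<in>S. \<exists>V. subspace V \<and> dim V = k \<and> N = {P\<in>S. x P - x P\<^sub>0 \<in> V})"

definition is_dual_complement ::
  "real \<Rightarrow> (real^'n \<Rightarrow> real) \<Rightarrow> 'p set \<Rightarrow> ('p \<Rightarrow> real^'n) \<Rightarrow> nat \<Rightarrow> 'p set \<Rightarrow> 'p \<Rightarrow> 'p set \<Rightarrow> bool"
  where
  "is_dual_complement \<alpha> \<phi> S \<theta> k E P\<^sub>0 M \<longleftrightarrow>
     maximal_autoparallel S (dual_coord \<alpha> \<phi> \<theta>) (CARD('n) - k) M \<and>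
     E \<inter> M = {P\<^sub>0} \<and>
     (\<forall>u\<in>tangent_space \<theta> E P\<^sub>0. \<forall>v\<in>tangent_space \<theta> M P\<^sub>0.
        riemann_inner \<alpha> \<phi> \<theta> P\<^sub>0 u v = 0)"

definition dual_complement ::
  "real \<Rightarrow> (real^'n \<Rightarrow> real) \<Rightarrow> 'p set \<Rightarrow> ('p \<Rightarrow> real^'n) \<Rightarrow> nat \<Rightarrow> 'p set \<Rightarrow> 'p \<Rightarrow> 'p set" where
  "dual_complement \<alpha> \<phi> S \<theta> k E P\<^sub>0 = (THE M. is_dual_complement \<alpha> \<phi> S \<theta> k E P\<^sub>0 M)"

text \<open>\<open>is_dual_projection \<alpha> \<phi> \<theta> A P Q\<close>: the point \<open>Q\<close> is a dual projection of \<open>P\<close> onto \<open>A\<close>.\<close>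

definition is_dual_projection ::
  "real \<Rightarrow> (real^'n \<Rightarrow> real) \<Rightarrow> ('p \<Rightarrow> real^'n) \<Rightarrow> 'p set \<Rightarrow> 'p \<Rightarrow> 'p \<Rightarrow> bool" where
  "is_dual_projection \<alpha> \<phi> \<theta> A P Q \<longleftrightarrow>
     is_arg_min (\<lambda>R. divergence \<alpha> \<phi> \<theta> R P) (\<lambda>R. R \<in> A) Q"

end

theory Submission
  imports Defs
begin

text \<open>
  Put \<open>w(x) = 1 - \<alpha> D\<phi>(x) \<bullet> x\<close> and \<open>L\<^sub>x a = a - \<alpha> (D\<phi>(x) \<bullet> a) x\<close>. Along the direction \<open>a\<close> at
  \<open>x = \<theta>(P\<^sub>0)\<close>, the derivative of \<open>R \<mapsto> D[R:P]\<close> vanishes iff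
  \<open>(\<eta>(P) - \<eta>(P\<^sub>0)) \<bullet> L\<^sub>x a = 0\<close>, a condition that is affine in \<open>\<eta>(P)\<close>. A critical point on an affine slice
  of \<open>\<Theta>\<close> is the unique minimum, by the strict tangent inequality for \<open>exp (\<alpha> \<phi>)\<close>. On the other
  hand the metric is \<open>\<langle>u, v\<rangle> = - w(x) (DT(x) v \<bullet> L\<^sub>x u)\<close>, so that the same linear condition
  describes the dual complement: its direction in dual coordinates is the orthogonal complement
  of \<open>L\<^sub>x V\<close>, where \<open>V\<close> is the direction of \<open>E\<close>. That nothing else can be the dual complement
  needs a curve in every tangent direction of a dual leaf, which the inverse function
  theorem for \<open>T\<close> supplies.
\<close>

section \<open>Gradient and Hessian as Frechet derivatives\<close>

lemma gradient_has_derivative: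
  fixes f :: "real^'n \<Rightarrow> real"
  assumes "f differentiable (at x)"
  shows "(f has_derivative (\<lambda>v. gradient f x \<bullet> v)) (at x)"
proof -
  let ?D = "frechet_derivative f (at x)"
  have D: "(f has_derivative ?D) (at x)"
    using assms frechet_derivative_works by blast
  then have lin: "linear ?D"
    by (rule has_derivative_linear)
  have "?D v = gradient f x \<bullet> v" for v
  proof -
    have "?D v = ?D (\<Sum>i\<in>UNIV. (v $ i) *\<^sub>R axis i 1)"
      using basis_expansion[of v] by (simp add: scalar_mult_eq_scaleR)
    also have "\<dots> = (\<Sum>i\<in>UNIV. v $ i * ?D (axis i 1))"
      by (simp add: linear_sum[OF lin] linear_cmul[OF lin])
    finally show ?thesis
      by (simp add: gradient_def partial_deriv_def inner_vec_def mult.commute)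
  qed
  then have "?D = (\<lambda>v. gradient f x \<bullet> v)" by blast
  with D show ?thesis by simp
qed

lemma partial_deriv_eqI:
  "(f has_derivative f') (at x) \<Longrightarrow> partial_deriv i f x = f' (axis i 1)"
  by (simp add: partial_deriv_def frechet_derivative_at[symmetric])

text \<open>The first index of \<open>hessian\<close> is the direction of differentiation, so the
  vector multiplies from the left.\<close>

lemma hessian_has_derivative:
  fixes f :: "real^'n \<Rightarrow> real"
  assumes "\<And>j. partial_deriv j f differentiable (at x)"
  shows "(gradient f has_derivative (\<lambda>v. v v* hessian f x)) (at x)"
proof -
  have "((\<lambda>y. gradient f y \<bullet> i) has_derivative (\<lambda>v. (v v* hessian f x) \<bullet> i)) (at x)"
    if "i \<in> Basis" for i
  proof -
    from that obtain j where i: "i = axis j 1"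
      by (auto simp: Basis_vec_def)
    have "gradient (partial_deriv j f) x \<bullet> v = (v v* hessian f x) \<bullet> axis j 1" for v
      by (simp only: inner_axis) (simp add: gradient_def hessian_def vector_matrix_mult_def inner_vec_def mult.commute)
    with gradient_has_derivative[OF assms[of j]] show ?thesis
      by (simp add: i inner_axis gradient_def)
  qed
  then show ?thesis
    by (subst has_derivative_componentwise_within) blast
qed

lemma scaleR_vector_matrix_mult:
  fixes v :: "real^'n" shows "(r *\<^sub>R v) v* A = r *\<^sub>R (v v* A)"
  by (simp add: vec_eq_iff vector_matrix_mult_def sum_distrib_left mult.assoc)

lemma axis_vector_matrix_mult:
  fixes A :: "real^'n^'m" shows "axis i 1 v* A = A $ i"
  by (simp add: vec_eq_iff vector_matrix_mult_def axis_def if_distrib[of "\<lambda>x. x * _"] cong: if_cong)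

section \<open>Curves in Euclidean space and their velocities\<close>

text \<open>Paired with a vector orthogonal to \<open>V\<close>, the displacement vanishes near
  \<open>0\<close>, so the velocity is orthogonal to that vector as well; the double orthogonal
  complement of \<open>V\<close> is \<open>V\<close>.\<close>

lemma velocity_in_subspace:
  fixes c :: "real \<Rightarrow> 'a::euclidean_space"
  assumes "subspace V" "\<epsilon> > 0" "\<And>t. t \<in> {-\<epsilon><..<\<epsilon>} \<Longrightarrow> c t - c 0 \<in> V"
    and "(c has_vector_derivative v) (at 0)"
  shows "v \<in> V"
proof -
  have "w \<bullet> v = 0" if w: "w \<in> V\<^sup>\<bottom>" for w
  proof -
    have "((\<lambda>t. w \<bullet> (c t - c 0)) has_vector_derivative w \<bullet> v) (at 0)"
      using assms(4) unfolding has_vector_derivative_def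
      by (auto intro!: derivative_eq_intros)
    moreover have "((\<lambda>t. w \<bullet> (c t - c 0)) has_vector_derivative 0) (at 0)"
    proof (rule has_vector_derivative_transform_within_open[where f = "\<lambda>_. 0"])
      show "open {-\<epsilon><..<\<epsilon>}" by simp
      show "0 = w \<bullet> (c t - c 0)" if "t \<in> {-\<epsilon><..<\<epsilon>}" for t
        using w assms(3)[OF that]
        by (metis (no_types, lifting) inner_commute mem_Collect_eq orthogonal_comp_def orthogonal_def)
    qed (use \<open>\<epsilon> > 0\<close> in auto)
    ultimately show ?thesis
      by (rule vector_derivative_unique_at)
  qed
  then have "v \<in> V\<^sup>\<bottom>\<^sup>\<bottom>"
    by (simp add: orthogonal_comp_def[of "V\<^sup>\<bottom>"] orthogonal_def)
  then show ?thesis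
    using orthogonal_comp_self[OF \<open>subspace V\<close>] by simp
qed

text \<open>The curve is a local inverse of \<open>T\<close> applied to the line
  \<open>T x + t *\<^sub>R (A x *v v)\<close>. Its velocity solves a linear system with matrix
  \<open>A (c t)\<close>, hence depends continuously on \<open>t\<close>.\<close>

lemma C1_curve_with_straight_image:
  fixes T :: "real^'n \<Rightarrow> real^'n" and A :: "real^'n \<Rightarrow> real^'n^'n"
  assumes "open U" "x \<in> U"
    and der: "\<And>y. y \<in> U \<Longrightarrow> (T has_derivative (*v) (A y)) (at y)"
    and cont: "continuous_on U A"
    and inv: "det (A x) \<noteq> 0"
  obtains \<epsilon> c where "\<epsilon> > 0" "c 0 = x" "c ` {-\<epsilon><..<\<epsilon>} \<subseteq> U"
    "\<And>t. t \<in> {-\<epsilon><..<\<epsilon>} \<Longrightarrow> T (c t) = T x + t *\<^sub>R (A x *v v)"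
    "c C1_differentiable_on {-\<epsilon><..<\<epsilon>}" "(c has_vector_derivative v) (at 0)"
proof -
  define T' where "T' y = Blinfun ((*v) (A y))" for y
  have T': "blinfun_apply (T' y) = (*v) (A y)" for y
    unfolding T'_def by (rule bounded_linear_Blinfun_apply) (rule matrix_vector_mul_bounded_linear)
  have "invertible (A x)"
    using inv by (simp add: invertible_det_nz)
  then obtain B where "B ** A x = mat 1"
    unfolding invertible_def by blast
  then have invf: "Blinfun ((*v) B) o\<^sub>L T' x = id_blinfun"
    by (intro blinfun_eqI)
       (simp add: T' bounded_linear_Blinfun_apply matrix_vector_mul_bounded_linear
         matrix_vector_mul_assoc)
  have contT': "continuous_on U T'"
    by (rule continuous_on_blinfun_componentwise)
       (auto simp: T' matrix_vector_mult_def intro!: continuous_intros cont)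
  obtain U' V g g' where IFT: "open U'" "U' \<subseteq> U" "x \<in> U'" "open V" "T x \<in> V" "homeomorphism U' V T g"
    and g: "\<And>y. y \<in> V \<Longrightarrow> (g has_derivative (g' y)) (at y)"
    and g': "\<And>y. y \<in> V \<Longrightarrow> g' y = Hilbert_Choice.inv (blinfun_apply (T' (g y)))"
    and bij: "\<And>y. y \<in> V \<Longrightarrow> bij (blinfun_apply (T' (g y)))"
    using inverse_function_theorem[of U T T' x, OF \<open>open U\<close> _ contT' \<open>x \<in> U\<close> invf] der T'
    by metis
  define b where "b = A x *v v"
  define l where "l t = T x + t *\<^sub>R b" for t
  have l: "(l has_vector_derivative b) (at t)" for t
    unfolding l_def by (auto intro!: derivative_eq_intros)
  have "open (l -` V)"
    by (rule open_vimage[OF \<open>open V\<close>]) (auto simp: l_def intro!: continuous_intros)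
  moreover have "0 \<in> l -` V" using IFT by (simp add: l_def)
  ultimately obtain \<epsilon> where \<epsilon>: "\<epsilon> > 0" "ball 0 \<epsilon> \<subseteq> l -` V"
    by (meson open_contains_ball)
  then have lV: "l t \<in> V" if "t \<in> {-\<epsilon><..<\<epsilon>}" for t
    using that by (auto simp: dist_norm subset_iff)
  define c where "c = g \<circ> l"
  have cU: "c t \<in> U" and Tc: "T (c t) = l t" if "t \<in> {-\<epsilon><..<\<epsilon>}" for t
    using lV[OF that] IFT by (auto simp: c_def homeomorphism_def)
  have c0: "c 0 = x"
    using IFT by (auto simp: c_def l_def homeomorphism_def)
  define c' where "c' t = g' (l t) b" for t
  have dc: "(c has_vector_derivative c' t) (at t)" if "t \<in> {-\<epsilon><..<\<epsilon>}" for t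
    unfolding c_def c'_def
    using diff_chain_at[OF l[of t, unfolded has_vector_derivative_def] g[OF lV[OF that]]]
      has_derivative_linear[OF g[OF lV[OF that]]]
    by (simp add: has_vector_derivative_def o_def linear_cmul)
  have Ac': "A (c t) *v c' t = b" and nz: "det (A (c t)) \<noteq> 0" if "t \<in> {-\<epsilon><..<\<epsilon>}" for t
  proof -
    have b: "bij ((*v) (A (c t)))" using bij[OF lV[OF that]] T' by (simp add: c_def)
    then show "A (c t) *v c' t = b"
      using g'[OF lV[OF that]] by (simp add: c'_def T' c_def bij_is_surj surj_f_inv_f)
    show "det (A (c t)) \<noteq> 0"
      using b by (metis invertible_det_nz invertible_eq_bij)
  qed
  have contc: "continuous_on {-\<epsilon><..<\<epsilon>} c"
    by (auto intro!: continuous_at_imp_continuous_on has_vector_derivative_continuous dc)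
  have contA: "continuous_on {-\<epsilon><..<\<epsilon>} (\<lambda>t. A (c t))"
    by (rule continuous_on_compose2[OF cont contc]) (use cU in auto)
  have contAij: "continuous_on {-\<epsilon><..<\<epsilon>} (\<lambda>t. if j = k then b $ i else A (c t) $ i $ j)" for i j k
    by (cases "j = k") (auto intro!: continuous_intros contA)
  \<comment> \<open>Cramer's rule expresses the velocity \<open>c'\<close> through continuous functions.\<close>
  have "continuous_on {-\<epsilon><..<\<epsilon>} (\<lambda>t. (\<chi> k. det (\<chi> i j. if j = k then b $ i else A (c t) $ i $ j) / det (A (c t))))"
    using nz unfolding det_def
    by (intro continuous_intros) (auto intro!: continuous_intros contA contAij)
  then have "continuous_on {-\<epsilon><..<\<epsilon>} c'"
    by (rule continuous_on_eq) (simp add: cramer[OF nz, THEN iffD1, OF _ Ac'])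
  with dc have "c C1_differentiable_on {-\<epsilon><..<\<epsilon>}"
    unfolding C1_differentiable_on_def by blast
  \<comment> \<open>At \<open>0\<close> the velocity equation reads
    \<open>A x *v c' 0 = A x *v v\<close>, and \<open>A x\<close> is injective.\<close>
  moreover have "c' 0 = v"
    using Ac'[of 0] \<epsilon>(1) \<open>invertible (A x)\<close>
    by (simp add: c0 b_def) (metis inj_matrix_vector_mult injD)
  ultimately show ?thesis
    using that[of \<epsilon> c] \<epsilon>(1) c0 cU Tc dc[of 0] by (auto simp: l_def b_def image_subset_iff)
qed


section \<open>Exponentially concave potentials in primal coordinates\<close>

locale alpha_exp_concave =
  fixes \<alpha> :: real and \<phi> :: "real^'n \<Rightarrow> real" and \<Theta> :: "(real^'n) set"
  assumes \<alpha>_pos: "\<alpha> > 0"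
    and open_\<Theta>: "open \<Theta>" and convex_\<Theta>: "convex \<Theta>"
    and smooth_\<phi>: "smooth_fun_on \<phi> \<Theta>"
    and hessian_neg: "\<lbrakk>x \<in> \<Theta>; v \<noteq> 0\<rbrakk> \<Longrightarrow> v \<bullet> (hessian (\<lambda>y. exp (\<alpha> * \<phi> y)) x *v v) < 0"
    and weight_pos': "x \<in> \<Theta> \<Longrightarrow> 1 - \<alpha> * (gradient \<phi> x \<bullet> x) > 0"
begin

abbreviation G where "G \<equiv> gradient \<phi>"
abbreviation H where "H \<equiv> hessian \<phi>"
abbreviation T where "T \<equiv> dual_map \<alpha> \<phi>"

definition weight :: "real^'n \<Rightarrow> real" where
  "weight x = 1 - \<alpha> * (G x \<bullet> x)"

text \<open>Quotient rule for \<open>dual_map\<close>; the second summand comes from the reciprocal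
  of \<open>weight\<close>.\<close>

definition dual_deriv :: "real^'n \<Rightarrow> real^'n \<Rightarrow> real^'n" where
  "dual_deriv x v = (1 / weight x) *\<^sub>R (v v* H x) +
     (\<alpha> * ((v v* H x) \<bullet> x + G x \<bullet> v) / (weight x)\<^sup>2) *\<^sub>R G x"

text \<open>Pairing a dual velocity with the lift of a primal one gives the metric, up to the factor
  \<open>- weight x\<close>; see \<open>dual_deriv_inner_lift\<close>.\<close>

definition lift :: "real^'n \<Rightarrow> real^'n \<Rightarrow> real^'n" where
  "lift x a = a - (\<alpha> * (G x \<bullet> a)) *\<^sub>R x"

lemma weight_pos: "x \<in> \<Theta> \<Longrightarrow> weight x > 0"
  using weight_pos' by (simp add: weight_def)

lemma \<phi>_differentiable: "x \<in> \<Theta> \<Longrightarrow> \<phi> differentiable (at x)"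
  and partial_differentiable: "x \<in> \<Theta> \<Longrightarrow> partial_deriv j \<phi> differentiable (at x)"
  and hessian_continuous: "continuous_on \<Theta> H"
proof -
  have "C_on 2 \<phi> \<Theta>" using smooth_\<phi> unfolding smooth_fun_on_def by blast
  then show "x \<in> \<Theta> \<Longrightarrow> \<phi> differentiable (at x)"
    and "x \<in> \<Theta> \<Longrightarrow> partial_deriv j \<phi> differentiable (at x)"
    and "continuous_on \<Theta> H"
    unfolding hessian_def by (auto simp: numeral_2_eq_2 intro!: continuous_intros)
qed

lemma has_derivative_\<phi> [derivative_intros]:
  assumes "x \<in> \<Theta>" shows "(\<phi> has_derivative (\<lambda>v. G x \<bullet> v)) (at x)"
  by (rule gradient_has_derivative[OF \<phi>_differentiable[OF assms]])

lemma has_derivative_G [derivative_intros]: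
  assumes "x \<in> \<Theta>" shows "(G has_derivative (\<lambda>v. v v* H x)) (at x)"
  by (rule hessian_has_derivative[OF partial_differentiable[OF assms]])

section \<open>Strict concavity of the exponential and its tangent inequality\<close>

lemma hessian_exp:
  assumes x: "x \<in> \<Theta>"
  shows "v \<bullet> (hessian (\<lambda>y. exp (\<alpha> * \<phi> y)) x *v v) =
    \<alpha> * exp (\<alpha> * \<phi> x) * ((v v* H x) \<bullet> v + \<alpha> * (G x \<bullet> v)\<^sup>2)"
proof -
  have p1: "partial_deriv j (\<lambda>y. exp (\<alpha> * \<phi> y)) y = \<alpha> * exp (\<alpha> * \<phi> y) * (G y $ j)"
    if "y \<in> \<Theta>" for y j
    by (subst partial_deriv_eqI[where f' = "\<lambda>v. exp (\<alpha> * \<phi> y) * (\<alpha> * (G y \<bullet> v))"])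
       (auto intro!: derivative_eq_intros that simp: inner_axis)
  have p2: "partial_deriv i (partial_deriv j (\<lambda>y. exp (\<alpha> * \<phi> y))) x =
      \<alpha> * exp (\<alpha> * \<phi> x) * (H x $ i $ j + \<alpha> * (G x $ i) * (G x $ j))" for i j
  proof (subst partial_deriv_eqI)
    have "((\<lambda>y. \<alpha> * exp (\<alpha> * \<phi> y) * (G y \<bullet> axis j 1)) has_derivative
        (\<lambda>v. \<alpha> * exp (\<alpha> * \<phi> x) * ((v v* H x) \<bullet> axis j 1 + \<alpha> * (G x \<bullet> v) * (G x \<bullet> axis j 1)))) (at x)"
      by (auto intro!: derivative_eq_intros x simp: algebra_simps)
    \<comment> \<open>The identity \<open>p1\<close> is available on \<open>\<Theta>\<close> only;
      as \<open>\<Theta>\<close> is open, this settles the derivative at \<open>x\<close>.\<close>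
    then show "(partial_deriv j (\<lambda>y. exp (\<alpha> * \<phi> y)) has_derivative
        (\<lambda>v. \<alpha> * exp (\<alpha> * \<phi> x) * ((v v* H x) \<bullet> axis j 1 + \<alpha> * (G x \<bullet> v) * (G x \<bullet> axis j 1)))) (at x)"
      by (rule has_derivative_transform_within_open[OF _ open_\<Theta> x]) (simp add: p1 inner_axis)
  qed (simp add: inner_axis axis_vector_matrix_mult)
  let ?c = "\<alpha> * exp (\<alpha> * \<phi> x)"
  have "v \<bullet> (hessian (\<lambda>y. exp (\<alpha> * \<phi> y)) x *v v) =
      (\<Sum>i\<in>UNIV. \<Sum>j\<in>UNIV. ?c * (v $ i * H x $ i $ j * v $ j) + ?c * \<alpha> * ((G x $ i * v $ i) * (G x $ j * v $ j)))"
    unfolding hessian_def[of "\<lambda>y. exp (\<alpha> * \<phi> y)"]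
    by (simp add: p2 inner_vec_def matrix_vector_mult_def sum_distrib_left algebra_simps)
  also have "\<dots> = ?c * (\<Sum>i\<in>UNIV. \<Sum>j\<in>UNIV. v $ i * H x $ i $ j * v $ j) + ?c * \<alpha> * (G x \<bullet> v)\<^sup>2"
    by (simp add: sum.distrib sum_distrib_left[symmetric] power2_eq_square inner_vec_def sum_product)
  also have "(\<Sum>i\<in>UNIV. \<Sum>j\<in>UNIV. v $ i * H x $ i $ j * v $ j) = (v v* H x) \<bullet> v"
    by (subst sum.swap) (simp add: inner_vec_def vector_matrix_mult_def sum_distrib_right)
  finally show ?thesis by (simp add: algebra_simps)
qed

text \<open>This is positive definiteness of the metric: the form is minus the squared length of
  \<open>v\<close>, see \<open>metric_matrix_eq\<close>.\<close>

lemma quadratic_neg: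
  assumes "x \<in> \<Theta>" "v \<noteq> 0"
  shows "(v v* H x) \<bullet> v + \<alpha> * (G x \<bullet> v)\<^sup>2 < 0"
  using hessian_neg[OF assms] \<alpha>_pos unfolding hessian_exp[OF assms(1)]
  by (simp add: mult_less_0_iff)

text \<open>Along the segment from \<open>x\<close> to \<open>y\<close> the second derivative of the
  exponential is negative, so its graph lies strictly below the tangent at \<open>x\<close>. The
  stated form results from division by \<open>exp (\<alpha> * \<phi> x)\<close>.\<close>

lemma tangent_inequality:
  assumes x: "x \<in> \<Theta>" and y: "y \<in> \<Theta>" and "x \<noteq> y"
  shows "exp (\<alpha> * (\<phi> y - \<phi> x)) < 1 + \<alpha> * (G x \<bullet> (y - x))"
proof -
  define v where "v = y - x"
  define c where "c t = x + t *\<^sub>R v" for t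
  have "v \<noteq> 0" using assms by (simp add: v_def)
  have c: "c t \<in> \<Theta>" if "0 \<le> t" "t \<le> 1" for t
    using convexD_alt[OF convex_\<Theta> x y that] by (simp add: c_def v_def algebra_simps)
  have dc: "(c has_derivative (\<lambda>h. h *\<^sub>R v)) (at t)" for t
    unfolding c_def by (auto intro!: derivative_eq_intros)
  define p where "p t = exp (\<alpha> * \<phi> (c t))" for t
  define p' where "p' t = p t * \<alpha> * (G (c t) \<bullet> v)" for t
  have dp: "(p has_real_derivative p' t) (at t)" if "0 \<le> t" "t \<le> 1" for t
    unfolding p_def p'_def has_field_derivative_def
    using has_derivative_compose[OF dc has_derivative_\<phi>[OF c[OF that]]]
    by (auto intro!: derivative_eq_intros)
  have dp': "(p' has_real_derivative p t * \<alpha> * ((v v* H (c t)) \<bullet> v + \<alpha> * (G (c t) \<bullet> v)\<^sup>2)) (at t)"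
    if "0 \<le> t" "t \<le> 1" for t
  proof -
    have dG: "((\<lambda>t. G (c t) \<bullet> v) has_real_derivative (v v* H (c t)) \<bullet> v) (at t)"
      using has_derivative_compose[OF dc has_derivative_G[OF c[OF that]]]
      unfolding has_field_derivative_def
      by (auto intro!: derivative_eq_intros simp: scaleR_vector_matrix_mult mult.commute)
    show ?thesis unfolding p'_def
      by (rule derivative_eq_intros dp[OF that] dG refl)+
         (simp add: p'_def algebra_simps power2_eq_square)
  qed
  have p'_less: "p' t < p' 0" if "0 < t" "t \<le> 1" for t
  proof (rule DERIV_neg_imp_decreasing[OF that(1)])
    fix s assume "0 \<le> s" "s \<le> t"
    with that have s: "0 \<le> s" "s \<le> 1" by auto
    have "p s * \<alpha> * ((v v* H (c s)) \<bullet> v + \<alpha> * (G (c s) \<bullet> v)\<^sup>2) < 0"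
      using quadratic_neg[OF c[OF s] \<open>v \<noteq> 0\<close>] \<alpha>_pos by (simp add: p_def mult_less_0_iff)
    with dp'[OF s] show "\<exists>y. (p' has_real_derivative y) (at s) \<and> y < 0"
      by blast
  qed
  \<comment> \<open>The mean value theorem turns the increment into a slope at a later time, which
    is below the initial slope \<open>p' 0\<close>.\<close>
  obtain t where "0 < t" "t < 1" "p 1 - p 0 = (1 - 0) * p' t"
    using MVT2[of 0 1 p p'] dp by auto
  with p'_less[of t] have "p 1 < p 0 + p' 0" by simp
  also have "\<dots> = exp (\<alpha> * \<phi> x) * (1 + \<alpha> * (G x \<bullet> (y - x)))"
    by (simp add: p'_def p_def c_def v_def algebra_simps)
  finally show ?thesis
    by (simp add: p_def c_def v_def right_diff_distrib exp_diff divide_simps mult.commute)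
qed

text \<open>The larger side of \<open>tangent_inequality\<close> exceeds an exponential. Hence the
  logarithm in \<open>L_divergence\<close> has a positive argument for any two points of
  \<open>\<Theta>\<close>.\<close>

lemma log_argument_pos:
  assumes "x \<in> \<Theta>" "y \<in> \<Theta>"
  shows "1 + \<alpha> * (G x \<bullet> (y - x)) > 0"
proof (cases "x = y")
  case False
  then show ?thesis
    using tangent_inequality[OF assms False] exp_gt_zero by (meson less_trans)
qed simp

section \<open>The derivative of the dual map and its pairing with lifts\<close>

lemma continuous_on_G: "continuous_on \<Theta> G"
  by (intro continuous_at_imp_continuous_on ballI has_derivative_continuous[OF has_derivative_G])

lemma has_derivative_dual_map:
  assumes x: "x \<in> \<Theta>"
  shows "(T has_derivative dual_deriv x) (at x)"
proof -
  have nz: "1 - \<alpha> * (G x \<bullet> x) \<noteq> 0" using weight_pos[OF x] by (simp add: weight_def)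
  have "((\<lambda>x. (1 / (1 - \<alpha> * (G x \<bullet> x))) *\<^sub>R G x) has_derivative dual_deriv x) (at x)"
    unfolding dual_deriv_def weight_def
    by (rule derivative_eq_intros x nz refl)+
       (auto simp: fun_eq_iff power2_eq_square algebra_simps)
  then show ?thesis unfolding dual_map_def .
qed

lemma linear_dual_deriv: "x \<in> \<Theta> \<Longrightarrow> linear (dual_deriv x)"
  by (rule has_derivative_linear[OF has_derivative_dual_map])

lemma linear_lift: "linear (lift x)"
  by (rule linearI) (auto simp: lift_def algebra_simps)

lemma continuous_dual_deriv: "continuous_on \<Theta> (\<lambda>x. matrix (dual_deriv x))"
proof -
  have "continuous_on \<Theta> (\<lambda>x. dual_deriv x v)" for v
    unfolding dual_deriv_def weight_def vector_matrix_mult_def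
    using weight_pos'
    by (intro continuous_intros hessian_continuous continuous_on_G) force+
  then show ?thesis
    unfolding matrix_def by (intro continuous_intros)
qed

text \<open>\<open>G x \<bullet> lift x u\<close> is \<open>weight x * (G x \<bullet> u)\<close>,
  which together with the outer factor clears all denominators; the two terms with
  \<open>(v v* H x) \<bullet> x\<close> then cancel.\<close>

lemma dual_deriv_inner_lift:
  assumes x: "x \<in> \<Theta>"
  shows "weight x * (dual_deriv x v \<bullet> lift x u) =
    (v v* H x) \<bullet> u + \<alpha> * (G x \<bullet> u) * (G x \<bullet> v)"
proof -
  define w where "w = weight x"
  have w: "w \<noteq> 0" and t: "\<alpha> * (G x \<bullet> x) = 1 - w"
    using weight_pos[OF x] by (simp_all add: w_def weight_def)
  define q where "q = \<alpha> * ((v v* H x) \<bullet> x + G x \<bullet> v)"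
  have "w * (dual_deriv x v \<bullet> lift x u) =
      (v v* H x) \<bullet> u - \<alpha> * (G x \<bullet> u) * ((v v* H x) \<bullet> x)
      + q / w * ((G x \<bullet> u) - (G x \<bullet> u) * (\<alpha> * (G x \<bullet> x)))"
    using w unfolding dual_deriv_def lift_def w_def[symmetric] q_def[symmetric]
    by (simp add: inner_add_left inner_diff_right power2_eq_square field_simps)
  also have "\<dots> = (v v* H x) \<bullet> u - \<alpha> * (G x \<bullet> u) * ((v v* H x) \<bullet> x) + q * (G x \<bullet> u)"
    using w unfolding t by (simp add: field_simps)
  finally show ?thesis by (simp add: w_def q_def algebra_simps)
qed

text \<open>Pairing \<open>dual_deriv x v\<close> with \<open>lift x v\<close> yields, up to a
  positive factor, the form of \<open>quadratic_neg\<close>.\<close>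

lemma inj_dual_deriv:
  assumes x: "x \<in> \<Theta>" shows "inj (dual_deriv x)"
proof (subst linear_injective_0[OF linear_dual_deriv[OF x]], intro allI impI, rule ccontr)
  fix v assume "dual_deriv x v = 0" "v \<noteq> 0"
  then show False
    using dual_deriv_inner_lift[OF x, of v v] quadratic_neg[OF x, of v]
    by (simp add: power2_eq_square algebra_simps)
qed

text \<open>A kernel vector is a multiple of \<open>x\<close>; pairing with \<open>G x\<close> shows
  that the multiple is zero, because \<open>weight x\<close> is nonzero.\<close>

lemma inj_lift:
  assumes x: "x \<in> \<Theta>" shows "inj (lift x)"
proof (subst linear_injective_0[OF linear_lift], intro allI impI)
  fix a assume "lift x a = 0"
  then have a: "a = (\<alpha> * (G x \<bullet> a)) *\<^sub>R x" by (simp add: lift_def)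
  have "G x \<bullet> a = (\<alpha> * (G x \<bullet> a)) * (G x \<bullet> x)" by (subst a) simp
  then have "weight x * (G x \<bullet> a) = 0" by (simp add: weight_def algebra_simps)
  with weight_pos[OF x] a show "a = 0" by simp
qed

section \<open>Critical points and minima of the divergence\<close>

text \<open>The right side says that the derivative of the divergence at \<open>x\<close> along
  \<open>a\<close> vanishes, with its denominator cleared. It becomes a condition on
  \<open>T z - T x\<close> because \<open>T x \<bullet> lift x a\<close> is just
  \<open>G x \<bullet> a\<close>.\<close>

lemma critical_iff:
  assumes x: "x \<in> \<Theta>" and z: "z \<in> \<Theta>"
  shows "(T z - T x) \<bullet> lift x a = 0 \<longleftrightarrow>
    G z \<bullet> a = (G x \<bullet> a) * (1 + \<alpha> * (G z \<bullet> (x - z)))"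
proof -
  have "G x \<bullet> lift x a = (G x \<bullet> a) * weight x"
    by (simp add: lift_def weight_def algebra_simps)
  then have "T x \<bullet> lift x a = G x \<bullet> a"
    using weight_pos[OF x] by (simp add: dual_map_def weight_def[symmetric])
  moreover have "T z \<bullet> lift x a = (G z \<bullet> a - \<alpha> * (G x \<bullet> a) * (G z \<bullet> x)) / weight z"
    by (simp add: dual_map_def weight_def[symmetric] lift_def inner_diff_right diff_divide_distrib)
  ultimately have "(T z - T x) \<bullet> lift x a = 0 \<longleftrightarrow>
      G z \<bullet> a - \<alpha> * (G x \<bullet> a) * (G z \<bullet> x) = (G x \<bullet> a) * weight z"
    using weight_pos[OF z] by (simp add: inner_diff_left divide_eq_eq)
  then show ?thesis
    by (simp add: weight_def algebra_simps)
qed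

text \<open>The argument \<open>l\<close> of the logarithm is affine, so criticality turns
  \<open>l y\<close> into \<open>l x\<close> times the larger side of
  \<open>tangent_inequality\<close>; taking logarithms gives the claim.\<close>

lemma critical_imp_strict_min:
  assumes x: "x \<in> \<Theta>" and y: "y \<in> \<Theta>" and z: "z \<in> \<Theta>" and "y \<noteq> x"
    and crit: "(T z - T x) \<bullet> lift x (y - x) = 0"
  shows "L_divergence \<alpha> \<phi> x z < L_divergence \<alpha> \<phi> y z"
proof -
  define l where "l u = 1 + \<alpha> * (G z \<bullet> (u - z))" for u
  have lx: "l x > 0" and ly: "l y > 0"
    using log_argument_pos x y z by (auto simp: l_def)
  have "l x * (1 + \<alpha> * (G x \<bullet> (y - x))) = l x + \<alpha> * (G z \<bullet> (y - x))"
    using crit[unfolded critical_iff[OF x z], folded l_def] by (simp add: distrib_left)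
  also have "\<dots> = l y" by (simp add: l_def algebra_simps)
  finally have "l x * exp (\<alpha> * (\<phi> y - \<phi> x)) < l y"
    using tangent_inequality[OF x y] lx \<open>y \<noteq> x\<close> by (metis mult_strict_left_mono)
  then have "ln (l x * exp (\<alpha> * (\<phi> y - \<phi> x))) < ln (l y)"
    using lx by (subst ln_less_cancel_iff) (use ly in auto)
  then have "ln (l x) + \<alpha> * (\<phi> y - \<phi> x) < ln (l y)"
    using lx by (simp add: ln_mult)
  then have "(ln (l x) + \<alpha> * (\<phi> y - \<phi> x)) / \<alpha> < ln (l y) / \<alpha>"
    using \<alpha>_pos by (rule divide_strict_right_mono)
  then show ?thesis
    using \<alpha>_pos by (simp add: L_divergence_def l_def[symmetric] add_divide_distrib)
qed

lemma has_derivative_L_divergence: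
  assumes y: "y \<in> \<Theta>" and z: "z \<in> \<Theta>"
  shows "((\<lambda>y. L_divergence \<alpha> \<phi> y z) has_derivative
    (\<lambda>v. (G z \<bullet> v) / (1 + \<alpha> * (G z \<bullet> (y - z))) - G y \<bullet> v)) (at y)"
  unfolding L_divergence_def
  by (rule derivative_eq_intros y z log_argument_pos refl)+ (use \<alpha>_pos in \<open>auto simp: divide_simps\<close>)

text \<open>The line through \<open>x\<close> in direction \<open>a\<close> stays in the slice, and
  in the open set \<open>\<Theta>\<close> for small times, so the derivative along it vanishes at
  the minimum.\<close>

lemma min_imp_critical:
  assumes x: "x \<in> \<Theta>" and z: "z \<in> \<Theta>" and V: "subspace V" "a \<in> V"
    and min: "\<And>y. \<lbrakk>y \<in> \<Theta>; y - x \<in> V\<rbrakk> \<Longrightarrow> L_divergence \<alpha> \<phi> x z \<le> L_divergence \<alpha> \<phi> y z"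
  shows "(T z - T x) \<bullet> lift x a = 0"
proof -
  define c where "c t = x + t *\<^sub>R a" for t
  have dc: "(c has_derivative (\<lambda>t. t *\<^sub>R a)) (at 0)"
    unfolding c_def by (auto intro!: derivative_eq_intros)
  have c0: "c 0 = x" by (simp add: c_def)
  let ?f = "\<lambda>t. L_divergence \<alpha> \<phi> (c t) z"
  let ?l = "1 + \<alpha> * (G z \<bullet> (x - z))"
  have "(?f has_real_derivative (G z \<bullet> a) / ?l - G x \<bullet> a) (at 0)"
    using has_derivative_compose[OF dc, unfolded c0, OF has_derivative_L_divergence[OF x z]]
    unfolding has_field_derivative_def
    by (rule has_derivative_eq_rhs) (simp add: fun_eq_iff left_diff_distrib)
  moreover have "open (c -` \<Theta>)"
    by (rule open_vimage[OF open_\<Theta>]) (auto simp: c_def intro!: continuous_intros)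
  then obtain d where d: "d > 0" "ball 0 d \<subseteq> c -` \<Theta>"
    using x c0 by (metis open_contains_ball vimage_eq)
  moreover have "?f 0 \<le> ?f t" if "\<bar>0 - t\<bar> < d" for t
    unfolding c0 using d that V
    by (intro min) (auto simp: c_def subset_iff dist_norm subspace_scale)
  ultimately have "(G z \<bullet> a) / ?l - G x \<bullet> a = 0"
    using DERIV_local_min by blast
  then show ?thesis
    unfolding critical_iff[OF x z] using log_argument_pos[OF z x] by (simp add: field_simps)
qed

section \<open>The metric as a Euclidean pairing\<close>

lemma metric_matrix_eq:
  assumes x: "x \<in> \<Theta>"
  shows "metric_matrix \<alpha> \<phi> x $ i $ j = - (H x $ j $ i + \<alpha> * G x $ i * G x $ j)"
proof -
  \<comment> \<open>This is needed for all \<open>y\<close> near \<open>x\<close>, since it is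
    differentiated in \<open>y\<close> next. It differentiates the gradient in direction
    \<open>j\<close>, whence the index order of \<open>H\<close>.\<close>
  have inner: "partial_deriv j (\<lambda>y'. L_divergence \<alpha> \<phi> y y') x =
      (H x $ j \<bullet> (y - x) - G x $ j) / (1 + \<alpha> * (G x \<bullet> (y - x))) + G x $ j"
    if y: "y \<in> \<Theta>" for y
  proof -
    have "((\<lambda>y'. L_divergence \<alpha> \<phi> y y') has_derivative
       (\<lambda>h. ((h v* H x) \<bullet> (y - x) - G x \<bullet> h) / (1 + \<alpha> * (G x \<bullet> (y - x))) + G x \<bullet> h)) (at x)"
      unfolding L_divergence_def
      by (rule derivative_eq_intros x log_argument_pos[OF x y] refl)+
         (use \<alpha>_pos log_argument_pos[OF x y] in \<open>auto simp: fun_eq_iff divide_simps\<close>)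
    from partial_deriv_eqI[OF this, of j] show ?thesis
      by (simp add: axis_vector_matrix_mult inner_axis)
  qed
  have "((\<lambda>y. (H x $ j \<bullet> (y - x) - G x $ j) / (1 + \<alpha> * (G x \<bullet> (y - x))) + G x $ j)
      has_derivative (\<lambda>u. H x $ j \<bullet> u + \<alpha> * (G x \<bullet> u) * G x $ j)) (at x)"
    by (auto intro!: derivative_eq_intros)
  then have "((\<lambda>y. partial_deriv j (\<lambda>y'. L_divergence \<alpha> \<phi> y y') x)
      has_derivative (\<lambda>u. H x $ j \<bullet> u + \<alpha> * (G x \<bullet> u) * G x $ j)) (at x)"
    by (rule has_derivative_transform_within_open[OF _ open_\<Theta> x]) (simp add: inner)
  from partial_deriv_eqI[OF this, of i] show ?thesis
    by (simp add: metric_matrix_def inner_axis)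
qed

text \<open>As \<open>weight\<close> is positive, this turns metric orthogonality of
  \<open>u\<close> and \<open>v\<close> into Euclidean orthogonality.\<close>

lemma riemann_inner_eq:
  assumes x: "\<theta> P \<in> \<Theta>"
  shows "riemann_inner \<alpha> \<phi> \<theta> P u v = - weight (\<theta> P) * (dual_deriv (\<theta> P) v \<bullet> lift (\<theta> P) u)"
proof -
  let ?x = "\<theta> P"
  have "riemann_inner \<alpha> \<phi> \<theta> P u v =
      - (\<Sum>i\<in>UNIV. \<Sum>j\<in>UNIV. v $ j * H ?x $ j $ i * u $ i + \<alpha> * ((G ?x $ i * u $ i) * (G ?x $ j * v $ j)))"
    by (simp add: riemann_inner_def metric_matrix_eq[OF x] sum_negf[symmetric] algebra_simps)
  also have "\<dots> = - ((v v* H ?x) \<bullet> u + \<alpha> * ((G ?x \<bullet> u) * (G ?x \<bullet> v)))"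
    by (simp add: sum.distrib sum_distrib_left[symmetric] inner_vec_def sum_product
         vector_matrix_mult_def sum_distrib_right)
  finally show ?thesis
    using dual_deriv_inner_lift[OF x, of v u] by (simp add: algebra_simps)
qed

end

section \<open>The manifold, its leaves and their normal spaces\<close>

locale alpha_manifold = alpha_exp_concave \<alpha> \<phi> \<Theta>
  for \<alpha> :: real and \<phi> :: "real^'n \<Rightarrow> real" and \<Theta> :: "(real^'n) set" +
  fixes S :: "'p set" and \<theta> :: "'p \<Rightarrow> real^'n"
  assumes chart: "bij_betw \<theta> S \<Theta>"
begin

abbreviation \<eta> where "\<eta> \<equiv> dual_coord \<alpha> \<phi> \<theta>"

text \<open>The coordinate map is an argument, so that \<open>\<theta>\<close> and
  \<open>\<eta>\<close> give the two kinds of autoparallel submanifolds.\<close>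

definition leaf :: "('p \<Rightarrow> real^'n) \<Rightarrow> 'p \<Rightarrow> (real^'n) set \<Rightarrow> 'p set" where
  "leaf x P V = {Q\<in>S. x Q - x P \<in> V}"

text \<open>The space is given in components with respect to the dual frame, so \<open>dual_deriv\<close> maps the metric
  orthogonal complement of \<open>V\<close> in primal components onto it.\<close>

definition normal_space :: "(real^'n) set \<Rightarrow> 'p \<Rightarrow> (real^'n) set" where
  "normal_space V P = {b. \<forall>a\<in>V. b \<bullet> lift (\<theta> P) a = 0}"

lemma chart_in: "P \<in> S \<Longrightarrow> \<theta> P \<in> \<Theta>"
  using chart by (auto simp: bij_betw_def)

lemma chart_inj: "\<lbrakk>P \<in> S; Q \<in> S; \<theta> P = \<theta> Q\<rbrakk> \<Longrightarrow> P = Q"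
  using chart by (auto simp: bij_betw_def inj_on_def)

lemma chart_inv: "x \<in> \<Theta> \<Longrightarrow> \<theta> (inv_into S \<theta> x) = x \<and> inv_into S \<theta> x \<in> S"
  using chart by (auto simp: bij_betw_def f_inv_into_f inv_into_into)

lemma leaf_base: "subspace V \<Longrightarrow> P \<in> S \<Longrightarrow> P \<in> leaf x P V"
  by (simp add: leaf_def subspace_0)

lemma leaf_rebase:
  assumes "subspace V" "Q \<in> leaf x P V"
  shows "leaf x P V = leaf x Q V"
proof -
  have "x R - x P \<in> V \<longleftrightarrow> x R - x Q \<in> V" for R
    using assms subspace_add[OF assms(1), of "x R - x Q" "x Q - x P"]
      subspace_diff[OF assms(1), of "x R - x P" "x Q - x P"]
    by (auto simp: leaf_def)
  then show ?thesis by (auto simp: leaf_def)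
qed

text \<open>By \<open>leaf_rebase\<close>, the base point hidden in
  \<open>maximal_autoparallel\<close> can be moved to any given point of \<open>N\<close>.\<close>

lemma maximal_autoparallel_iff:
  assumes "P \<in> N"
  shows "maximal_autoparallel S x k N \<longleftrightarrow>
    P \<in> S \<and> (\<exists>V. subspace V \<and> dim V = k \<and> N = leaf x P V)"
proof
  assume "maximal_autoparallel S x k N"
  then obtain Q V where Q: "Q \<in> S" "subspace V" "dim V = k" "N = leaf x Q V"
    unfolding maximal_autoparallel_def leaf_def by blast
  with assms leaf_rebase[of V P x Q] show "P \<in> S \<and> (\<exists>V. subspace V \<and> dim V = k \<and> N = leaf x P V)"
    by (auto simp: leaf_def)
qed (auto simp: maximal_autoparallel_def leaf_def)

lemma subspace_normal_space: "subspace (normal_space V P)"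
  by (auto simp: normal_space_def subspace_def inner_add_left)

text \<open>\<open>normal_space V P\<close> is the Euclidean orthogonal complement of the lifted
  \<open>V\<close>, and lifting is injective.\<close>

lemma dim_normal_space:
  assumes "subspace V" "P \<in> S"
  shows "dim (normal_space V P) = CARD('n) - dim V"
proof -
  let ?L = "lift (\<theta> P) ` V"
  have "dim {y \<in> UNIV. \<forall>x\<in>?L. orthogonal x y} + dim ?L = dim (UNIV :: (real^'n) set)"
    using assms(1) by (intro dim_subspace_orthogonal_to_vectors linear_subspace_image linear_lift) auto
  moreover have "{y \<in> UNIV. \<forall>x\<in>?L. orthogonal x y} = normal_space V P"
    by (auto simp: normal_space_def orthogonal_def inner_commute)
  moreover have "dim ?L = dim V"
    by (intro dim_image_eq linear_lift inj_on_subset[OF inj_lift[OF chart_in[OF assms(2)]]]) auto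
  ultimately show ?thesis by simp
qed

section \<open>Tangent spaces of primal and dual leaves\<close>

text \<open>The inverse chart moves a coordinate curve to the manifold. Its values are controlled on
  the open interval only, which is enough for the derivatives.\<close>

lemma velocity_if_mem:
  assumes "\<epsilon> > 0" "c ` {-\<epsilon><..<\<epsilon>} \<subseteq> \<Theta>" "c 0 = \<theta> P" "P \<in> S"
    and "\<And>t. t \<in> {-\<epsilon><..<\<epsilon>} \<Longrightarrow> inv_into S \<theta> (c t) \<in> N"
    and "c C1_differentiable_on {-\<epsilon><..<\<epsilon>}" "(c has_vector_derivative v) (at 0)"
  shows "v \<in> tangent_space \<theta> N P"
proof -
  define \<gamma> where "\<gamma> t = inv_into S \<theta> (c t)" for t
  have \<theta>\<gamma>: "\<theta> (\<gamma> t) = c t" if "t \<in> {-\<epsilon><..<\<epsilon>}" for t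
    using chart_inv[of "c t"] assms(2) that unfolding \<gamma>_def by blast
  have "(\<lambda>t. \<theta> (\<gamma> t)) C1_differentiable_on {-\<epsilon><..<\<epsilon>}"
  proof -
    obtain D where D: "\<And>t. t \<in> {-\<epsilon><..<\<epsilon>} \<Longrightarrow> (c has_vector_derivative D t) (at t)"
      "continuous_on {-\<epsilon><..<\<epsilon>} D"
      using assms(6) unfolding C1_differentiable_on_def by blast
    have "((\<lambda>t. \<theta> (\<gamma> t)) has_vector_derivative D t) (at t)" if "t \<in> {-\<epsilon><..<\<epsilon>}" for t
      by (rule has_vector_derivative_transform_within_open[OF D(1)[OF that] _ that])
         (use \<theta>\<gamma> in auto)
    with D(2) show ?thesis unfolding C1_differentiable_on_def by blast
  qed
  moreover have "((\<lambda>t. \<theta> (\<gamma> t)) has_vector_derivative v) (at 0)"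
    by (rule has_vector_derivative_transform_within_open[OF assms(7), of "{-\<epsilon><..<\<epsilon>}"])
       (use \<theta>\<gamma> assms(1) in auto)
  moreover have "\<gamma> 0 = P"
    using chart by (simp add: \<gamma>_def assms(3,4) bij_betw_def inv_into_f_f)
  ultimately show ?thesis
    unfolding tangent_space_def using assms(1,5) by (auto simp: \<gamma>_def intro!: exI[of _ \<gamma>] exI[of _ \<epsilon>])
qed

lemma tangent_space_primal_leaf:
  assumes V: "subspace V" and P: "P \<in> S"
  shows "tangent_space \<theta> (leaf \<theta> P V) P = V"
proof (intro equalityI subsetI)
  fix v assume "v \<in> tangent_space \<theta> (leaf \<theta> P V) P"
  then obtain \<gamma> \<epsilon> where \<gamma>: "\<epsilon> > 0" "\<gamma> ` {-\<epsilon><..<\<epsilon>} \<subseteq> leaf \<theta> P V" "\<gamma> 0 = P"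
    "((\<lambda>t. \<theta> (\<gamma> t)) has_vector_derivative v) (at 0)"
    unfolding tangent_space_def by blast
  show "v \<in> V"
    by (rule velocity_in_subspace[OF V \<gamma>(1) _ \<gamma>(4)]) (use \<gamma>(2,3) in \<open>force simp: leaf_def\<close>)
next
  fix v assume v: "v \<in> V"
  define c where "c t = \<theta> P + t *\<^sub>R v" for t
  have "open (c -` \<Theta>)"
    by (rule open_vimage[OF open_\<Theta>]) (auto simp: c_def intro!: continuous_intros)
  moreover have "0 \<in> c -` \<Theta>" using chart_in[OF P] by (simp add: c_def)
  ultimately obtain \<epsilon> where \<epsilon>: "\<epsilon> > 0" "ball 0 \<epsilon> \<subseteq> c -` \<Theta>"
    by (meson open_contains_ball)
  then have c\<Theta>: "c t \<in> \<Theta>" if "t \<in> {-\<epsilon><..<\<epsilon>}" for t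
    using that by (auto simp: dist_norm subset_iff)
  have dc: "(c has_vector_derivative v) (at t)" for t
    unfolding c_def by (auto intro!: derivative_eq_intros)
  show "v \<in> tangent_space \<theta> (leaf \<theta> P V) P"
  proof (rule velocity_if_mem[OF \<epsilon>(1) _ _ P _ _ dc])
    show "inv_into S \<theta> (c t) \<in> leaf \<theta> P V" if "t \<in> {-\<epsilon><..<\<epsilon>}" for t
      using chart_inv[OF c\<Theta>[OF that]] v V by (auto simp: leaf_def c_def subspace_scale)
    show "c C1_differentiable_on {-\<epsilon><..<\<epsilon>}"
      unfolding C1_differentiable_on_def using dc by (intro exI[of _ "\<lambda>_. v"]) auto
  qed (use c\<Theta> in \<open>auto simp: c_def\<close>)
qed

text \<open>One direction is the chain rule for \<open>T\<close>. Conversely, \<open>v\<close> is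
  the velocity of the curve whose \<open>T\<close> image is a straight line in direction
  \<open>dual_deriv (\<theta> P) v\<close>.\<close>

lemma tangent_space_dual_leaf:
  assumes W: "subspace W" and P: "P \<in> S"
  shows "v \<in> tangent_space \<theta> (leaf \<eta> P W) P \<longleftrightarrow> dual_deriv (\<theta> P) v \<in> W"
proof
  assume "v \<in> tangent_space \<theta> (leaf \<eta> P W) P"
  then obtain \<gamma> \<epsilon> where \<gamma>: "\<epsilon> > 0" "\<gamma> ` {-\<epsilon><..<\<epsilon>} \<subseteq> leaf \<eta> P W" "\<gamma> 0 = P"
    "((\<lambda>t. \<theta> (\<gamma> t)) has_vector_derivative v) (at 0)"
    unfolding tangent_space_def by blast
  have "((\<lambda>t. \<eta> (\<gamma> t)) has_vector_derivative dual_deriv (\<theta> P) v) (at 0)"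
    using has_derivative_compose[OF \<gamma>(4)[unfolded has_vector_derivative_def], unfolded \<gamma>(3),
        OF has_derivative_dual_map[OF chart_in[OF P]]]
    by (simp add: has_vector_derivative_def dual_coord_def linear_cmul[OF linear_dual_deriv[OF chart_in[OF P]]])
  then show "dual_deriv (\<theta> P) v \<in> W"
    by (rule velocity_in_subspace[OF W \<gamma>(1), rotated]) (use \<gamma>(2,3) in \<open>force simp: leaf_def\<close>)
next
  let ?x = "\<theta> P"
  have x: "?x \<in> \<Theta>" by (rule chart_in[OF P])
  have mat: "matrix (dual_deriv y) *v u = dual_deriv y u" if "y \<in> \<Theta>" for y u
    using matrix_works linear_dual_deriv[OF that] by (metis linear_matrix_vector_mul_eq)
  assume v: "dual_deriv ?x v \<in> W"
  have "det (matrix (dual_deriv ?x)) \<noteq> 0"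
    using det_nz_iff_inj linear_dual_deriv inj_dual_deriv x by blast
  moreover have "(T has_derivative (*v) (matrix (dual_deriv y))) (at y)" if "y \<in> \<Theta>" for y
    using has_derivative_dual_map[OF that] by (rule has_derivative_eq_rhs) (simp add: fun_eq_iff mat[OF that])
  ultimately obtain \<epsilon> c where c: "\<epsilon> > 0" "c 0 = ?x" "c ` {-\<epsilon><..<\<epsilon>} \<subseteq> \<Theta>"
    "\<And>t. t \<in> {-\<epsilon><..<\<epsilon>} \<Longrightarrow> T (c t) = T ?x + t *\<^sub>R (matrix (dual_deriv ?x) *v v)"
    "c C1_differentiable_on {-\<epsilon><..<\<epsilon>}" "(c has_vector_derivative v) (at 0)"
    using C1_curve_with_straight_image[OF open_\<Theta> x _ continuous_dual_deriv] by metis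
  show "v \<in> tangent_space \<theta> (leaf \<eta> P W) P"
  proof (rule velocity_if_mem[OF c(1,3,2) P _ c(5,6)])
    fix t assume t: "t \<in> {-\<epsilon><..<\<epsilon>}"
    with c(3) have "c t \<in> \<Theta>" by blast
    from chart_inv[OF this] c(4)[OF t] v W show "inv_into S \<theta> (c t) \<in> leaf \<eta> P W"
      by (auto simp: leaf_def dual_coord_def mat[OF x] subspace_scale)
  qed
qed

section \<open>Dual projections and the dual complement\<close>

text \<open>Both sides say that \<open>P\<close> is critical for the divergence to \<open>Q\<close>
  on the primal leaf: critical points are minima by \<open>critical_imp_strict_min\<close>, and
  minima are critical by \<open>min_imp_critical\<close>.\<close>

lemma leaf_normal_space_iff:
  assumes V: "subspace V" and P: "P \<in> S" and Q: "Q \<in> S"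
  shows "Q \<in> leaf \<eta> P (normal_space V P) \<longleftrightarrow> is_dual_projection \<alpha> \<phi> \<theta> (leaf \<theta> P V) Q P"
proof
  assume L: "Q \<in> leaf \<eta> P (normal_space V P)"
  have "divergence \<alpha> \<phi> \<theta> P Q \<le> divergence \<alpha> \<phi> \<theta> R Q" if "R \<in> leaf \<theta> P V" for R
  proof (cases "\<theta> R = \<theta> P")
    case False
    with that L critical_imp_strict_min[of "\<theta> P" "\<theta> R" "\<theta> Q"] chart_in P Q show ?thesis
      by (auto simp: leaf_def normal_space_def dual_coord_def divergence_def intro: less_imp_le)
  qed (simp add: divergence_def)
  then show "is_dual_projection \<alpha> \<phi> \<theta> (leaf \<theta> P V) Q P"
    using leaf_base[OF V P] by (force simp: is_dual_projection_def is_arg_min_def)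
next
  assume M: "is_dual_projection \<alpha> \<phi> \<theta> (leaf \<theta> P V) Q P"
  have "L_divergence \<alpha> \<phi> (\<theta> P) (\<theta> Q) \<le> L_divergence \<alpha> \<phi> y (\<theta> Q)"
    if "y \<in> \<Theta>" "y - \<theta> P \<in> V" for y
  proof -
    have "inv_into S \<theta> y \<in> leaf \<theta> P V"
      using chart_inv[OF that(1)] that(2) by (simp add: leaf_def)
    with M chart_inv[OF that(1)] show ?thesis
      by (force simp: is_dual_projection_def is_arg_min_def divergence_def not_less)
  qed
  then show "Q \<in> leaf \<eta> P (normal_space V P)"
    using min_imp_critical[OF chart_in[OF P] chart_in[OF Q] V] Q
    by (auto simp: leaf_def normal_space_def dual_coord_def)
qed

lemma dual_projection_unique:
  assumes V: "subspace V" and P: "P \<in> S" and Q: "Q \<in> S"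
    and proj: "is_dual_projection \<alpha> \<phi> \<theta> (leaf \<theta> P V) Q P"
    and R: "is_dual_projection \<alpha> \<phi> \<theta> (leaf \<theta> P V) Q R"
  shows "R = P"
proof (rule ccontr)
  assume "R \<noteq> P"
  have RV: "R \<in> leaf \<theta> P V" using R by (simp add: is_dual_projection_def is_arg_min_def)
  then have "\<theta> R \<noteq> \<theta> P" using \<open>R \<noteq> P\<close> chart_inj P by (auto simp: leaf_def)
  moreover have "Q \<in> leaf \<eta> P (normal_space V P)"
    using proj leaf_normal_space_iff[OF V P Q] by simp
  ultimately have "divergence \<alpha> \<phi> \<theta> P Q < divergence \<alpha> \<phi> \<theta> R Q"
    using critical_imp_strict_min[of "\<theta> P" "\<theta> R" "\<theta> Q"] chart_in P Q RV
    by (auto simp: leaf_def normal_space_def dual_coord_def divergence_def)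
  with R leaf_base[OF V P, of \<theta>] show False
    by (auto simp: is_dual_projection_def is_arg_min_def)
qed

text \<open>A point \<open>Q\<close> of the intersection is its own dual projection onto the primal
  leaf, as it lies on the dual leaf based at itself, and \<open>P\<close> is one as well; uniqueness
  identifies them.\<close>

lemma leaf_normal_space_inter:
  assumes V: "subspace V" and P: "P \<in> S"
  shows "leaf \<theta> P V \<inter> leaf \<eta> P (normal_space V P) = {P}"
proof (intro equalityI subsetI)
  fix Q assume Q: "Q \<in> leaf \<theta> P V \<inter> leaf \<eta> P (normal_space V P)"
  then have QS: "Q \<in> S" by (simp add: leaf_def)
  have "Q \<in> leaf \<eta> Q (normal_space V Q)"
    using leaf_base[OF subspace_normal_space QS] .
  then have "is_dual_projection \<alpha> \<phi> \<theta> (leaf \<theta> P V) Q Q"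
    using leaf_normal_space_iff[OF V QS QS] leaf_rebase[OF V, of Q \<theta> P] Q by simp
  moreover have "is_dual_projection \<alpha> \<phi> \<theta> (leaf \<theta> P V) Q P"
    using leaf_normal_space_iff[OF V P QS] Q by simp
  ultimately show "Q \<in> {P}"
    using dual_projection_unique[OF V P QS] by simp
qed (use leaf_base[OF _ P] V subspace_normal_space in auto)

lemma orthogonal_iff:
  assumes V: "subspace V" and W: "subspace W" and P: "P \<in> S"
  shows "(\<forall>u\<in>tangent_space \<theta> (leaf \<theta> P V) P. \<forall>v\<in>tangent_space \<theta> (leaf \<eta> P W) P.
      riemann_inner \<alpha> \<phi> \<theta> P u v = 0) \<longleftrightarrow> W \<subseteq> normal_space V P"
proof -
  have x: "\<theta> P \<in> \<Theta>" by (rule chart_in[OF P])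
  have surj: "surj (dual_deriv (\<theta> P))"
    by (rule linear_inj_imp_surj[OF linear_dual_deriv[OF x] inj_dual_deriv[OF x]])
  have inner_zero: "riemann_inner \<alpha> \<phi> \<theta> P u v = 0 \<longleftrightarrow> dual_deriv (\<theta> P) v \<bullet> lift (\<theta> P) u = 0" for u v
    using riemann_inner_eq[of \<theta> P u v] x weight_pos[OF x] by simp
  \<comment> \<open>Surjectivity of \<open>dual_deriv\<close> ensures that the orthogonality
    condition tests every vector of \<open>W\<close>.\<close>
  have image: "dual_deriv (\<theta> P) ` tangent_space \<theta> (leaf \<eta> P W) P = W" (is "?D ` ?TM = _")
  proof (intro equalityI subsetI)
    fix b assume "b \<in> W"
    moreover obtain v where "b = ?D v"
      using surj by (rule surjE)
    ultimately show "b \<in> ?D ` ?TM"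
      using tangent_space_dual_leaf[OF W P] by blast
  qed (use tangent_space_dual_leaf[OF W P] in blast)
  have "W \<subseteq> normal_space V P \<longleftrightarrow> (\<forall>v\<in>?TM. ?D v \<in> normal_space V P)"
    using image_subset_iff[of ?D ?TM "normal_space V P"] unfolding image .
  with inner_zero show ?thesis
    unfolding tangent_space_primal_leaf[OF V P] by (auto simp: normal_space_def)
qed

text \<open>For uniqueness, orthogonality forces the direction of a candidate into the normal space,
  and the dimensions agree.\<close>

lemma dual_complement_eq:
  assumes V: "subspace V" "dim V = k" and P: "P \<in> S"
  shows "dual_complement \<alpha> \<phi> S \<theta> k (leaf \<theta> P V) P = leaf \<eta> P (normal_space V P)"
  unfolding dual_complement_def
proof (rule the_equality)
  let ?N = "normal_space V P"
  have N: "subspace ?N" "dim ?N = CARD('n) - k"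
    using subspace_normal_space dim_normal_space[OF V(1) P] V(2) by auto
  show "is_dual_complement \<alpha> \<phi> S \<theta> k (leaf \<theta> P V) P (leaf \<eta> P ?N)"
    unfolding is_dual_complement_def
      maximal_autoparallel_iff[OF leaf_base[OF N(1) P]] orthogonal_iff[OF V(1) N(1) P]
    using leaf_normal_space_inter[OF V(1) P] N P by blast
  fix M assume M: "is_dual_complement \<alpha> \<phi> S \<theta> k (leaf \<theta> P V) P M"
  then have "P \<in> M" by (auto simp: is_dual_complement_def)
  then obtain W where W: "subspace W" "dim W = CARD('n) - k" "M = leaf \<eta> P W"
    using M maximal_autoparallel_iff[of P M \<eta>] by (auto simp: is_dual_complement_def)
  then have "W \<subseteq> ?N"
    using M orthogonal_iff[OF V(1) W(1) P] by (auto simp: is_dual_complement_def)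
  then have "W = ?N"
    using subspace_dim_equal[OF W(1) N(1)] W(2) N(2) by simp
  then show "M = leaf \<eta> P ?N" using W(3) by simp
qed

end

theorem theorem3:
  fixes \<alpha> :: real
    and \<Theta> :: "(real^'n::finite) set"
    and \<phi> :: "real^'n \<Rightarrow> real"
    and S :: "'p set"
    and \<theta> :: "'p \<Rightarrow> real^'n"
    and k :: nat
    and E :: "'p set"
  assumes "\<alpha> > 0"
    and "open \<Theta>" and "convex \<Theta>" and "\<Theta> \<noteq> {}"
    and "smooth_fun_on \<phi> \<Theta>"
    and "concave_on \<Theta> (\<lambda>x. exp (\<alpha> * \<phi> x))"
    and "\<And>x v. x \<in> \<Theta> \<Longrightarrow> v \<noteq> 0 \<Longrightarrow> v \<bullet> (hessian (\<lambda>y. exp (\<alpha> * \<phi> y)) x *v v) < 0"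
    and "\<And>x. x \<in> \<Theta> \<Longrightarrow> 1 - \<alpha> * (gradient \<phi> x \<bullet> x) > 0"
    and "bij_betw \<theta> S \<Theta>"
    and "1 \<le> k" and "k < CARD('n)"
    and "maximal_autoparallel S \<theta> k E"
  shows "(\<forall>P\<^sub>0\<in>E. \<forall>P\<in>dual_complement \<alpha> \<phi> S \<theta> k E P\<^sub>0. is_dual_projection \<alpha> \<phi> \<theta> E P P\<^sub>0) \<and>
    (\<forall>P\<^sub>0\<in>E. dual_complement \<alpha> \<phi> S \<theta> k E P\<^sub>0 = {P\<in>S. is_dual_projection \<alpha> \<phi> \<theta> E P P\<^sub>0}) \<and>
    (\<forall>P\<^sub>0\<in>E. \<forall>P\<^sub>1\<in>E. P\<^sub>0 \<noteq> P\<^sub>1 \<longrightarrow>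
      dual_complement \<alpha> \<phi> S \<theta> k E P\<^sub>0 \<inter> dual_complement \<alpha> \<phi> S \<theta> k E P\<^sub>1 = {})"
proof -
  interpret alpha_manifold \<alpha> \<phi> \<Theta> S \<theta>
    by unfold_locales (use assms in auto)
  have E: "dual_complement \<alpha> \<phi> S \<theta> k E P = {Q\<in>S. is_dual_projection \<alpha> \<phi> \<theta> E Q P}"
    and unique: "\<And>Q R. \<lbrakk>Q \<in> S; is_dual_projection \<alpha> \<phi> \<theta> E Q P; is_dual_projection \<alpha> \<phi> \<theta> E Q R\<rbrakk> \<Longrightarrow> R = P"
    if "P \<in> E" for P
  proof -
    \<comment> \<open>Each point of \<open>E\<close> can serve as its base point, so the results on
      leaves apply at \<open>P\<close>.\<close>
    from maximal_autoparallel_iff[OF that] assms(12) obtain V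
      where V: "P \<in> S" "subspace V" "dim V = k" "E = leaf \<theta> P V" by blast
    show "dual_complement \<alpha> \<phi> S \<theta> k E P = {Q\<in>S. is_dual_projection \<alpha> \<phi> \<theta> E Q P}"
      unfolding V(4) dual_complement_eq[OF V(2,3,1)]
      using leaf_normal_space_iff[OF V(2,1)] by (auto simp: leaf_def)
    show "R = P" if "Q \<in> S" "is_dual_projection \<alpha> \<phi> \<theta> E Q P" "is_dual_projection \<alpha> \<phi> \<theta> E Q R" for Q R
      using dual_projection_unique[OF V(2,1)] that by (simp add: V(4))
  qed
  show ?thesis
  proof (intro conjI ballI impI)
    \<comment> \<open>A common point would have two distinct dual projections onto
      \<open>E\<close>.\<close>
    fix P\<^sub>0 P\<^sub>1 assume "P\<^sub>0 \<in> E" "P\<^sub>1 \<in> E" "P\<^sub>0 \<noteq> P\<^sub>1"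
    with unique[of P\<^sub>0 _ P\<^sub>1] show
      "dual_complement \<alpha> \<phi> S \<theta> k E P\<^sub>0 \<inter> dual_complement \<alpha> \<phi> S \<theta> k E P\<^sub>1 = {}"
      unfolding E[OF \<open>P\<^sub>0 \<in> E\<close>] E[OF \<open>P\<^sub>1 \<in> E\<close>] by blast
  qed (simp_all add: E)
qed

end
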